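(* Let $\mathcal{H}_d$ be a $d$-dimensional complex Hilbert space. For every $a\in[0,1]$ with $a\ne d$, the map $R_a:B(\mathcal{H}_d)\to B(\mathcal{H}_d)$, $$R_a(X)=\frac{1}{d-a}\big(\mathrm{Tr}(X)\,\mathbf{1}_d-a\,X\big),$$ is KS-decomposable.
   Context: $B(\mathcal{H}_d)$ is the algebra of linear operators on $\mathcal{H}_d$ and $\mathbf{1}_d$ its identity; operator inequalities are in the positive semidefinite order. A unital linear map $\Psi:B(\mathcal{H}_d)\to B(\mathcal{H}_d)$ is a Kadison--Schwarz (KS) operator if $\Psi(X^*X)\ge\Psi(X)^*\Psi(X)$ for all $X\in B(\mathcal{H}_d)$, and a co-Kadison--Schwarz (co-KS) operator if $\Psi(X^*X)\ge\Psi(X)\Psi(X)^*$ for all $X\in B(\mathcal{H}_d)$. A unital positive linear map $\Phi:B(\mathcal{H}_d)\to B(\mathcal{H}_d)$ is KS-decomposable if there exist a unital KS operator $\Phi_1$, a unital co-KS operator $\Phi_2$ and $\lambda\in[0,1]$ such that $\Phi=\lambda\Phi_1+(1-\lambda)\Phi_2$. *)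

theory Defs
  imports "HOL-Analysis.Analysis" "HOL-Library.Complex_Order"
begin

text \<open>A \<open>d\<close>-dimensional complex Hilbert space is taken to be \<open>complex ^ 'n\<close> with
  \<open>d = CARD('n)\<close> and its standard sesquilinear inner product, so that \<open>B(H)\<close> is the algebra
  of square matrices with product \<open>**\<close> and identity \<open>mat 1\<close>.  (The operation \<open>*\<close> on
  \<open>complex ^ 'n ^ 'n\<close> is the entrywise product and the constant \<open>1\<close> the all-ones matrix;
  neither is used.)\<close>

type_synonym 'n op = "complex ^ 'n ^ 'n"

definition cinner :: "complex ^ 'n \<Rightarrow> complex ^ 'n \<Rightarrow> complex" where
  "cinner v w = (\<Sum>i\<in>UNIV. cnj (v $ i) * w $ i)"

definition adj :: "'n::finite op \<Rightarrow> 'n op" where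
  "adj A = (\<chi> i j. cnj (A $ j $ i))"

lemma cinner_adj: "cinner (adj A *v v) w = cinner v (A *v w)"
proof -
  have "cinner (adj A *v v) w = (\<Sum>i\<in>UNIV. \<Sum>j\<in>UNIV. A $ j $ i * cnj (v $ j) * w $ i)"
    by (simp add: cinner_def adj_def matrix_vector_mult_def sum_distrib_right)
  also have "\<dots> = (\<Sum>j\<in>UNIV. \<Sum>i\<in>UNIV. A $ j $ i * cnj (v $ j) * w $ i)"
    by (rule sum.swap)
  also have "\<dots> = cinner v (A *v w)"
    by (simp add: cinner_def matrix_vector_mult_def sum_distrib_left mult_ac)
  finally show ?thesis .
qed

text \<open>Complex scalar multiplication of operators; the library provides only the real one,
  \<open>*\<^sub>R\<close>.\<close>

definition op_scale :: "complex \<Rightarrow> 'n::finite op \<Rightarrow> 'n op" where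
  "op_scale c A = (\<chi> i j. c * A $ i $ j)"

lemma vector_space_op_scale: "vector_space op_scale"
  by unfold_locales (simp_all add: op_scale_def vec_eq_iff algebra_simps)

text \<open>In the order on \<open>complex\<close>, \<open>0 \<le> z\<close> says that \<open>z\<close> is real and non-negative; so \<open>psd\<close>
  entails self-adjointness.\<close>

definition psd :: "'n::finite op \<Rightarrow> bool" where
  "psd A \<longleftrightarrow> (\<forall>v. 0 \<le> cinner v (A *v v))"

definition op_le :: "'n::finite op \<Rightarrow> 'n op \<Rightarrow> bool" where
  "op_le A B \<longleftrightarrow> psd (B - A)"

definition unital_linear :: "('n::finite op \<Rightarrow> 'n op) \<Rightarrow> bool" where
  "unital_linear \<Psi> \<longleftrightarrow> Vector_Spaces.linear op_scale op_scale \<Psi> \<and> \<Psi> (mat 1) = mat 1"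

definition positive_map :: "('n::finite op \<Rightarrow> 'n op) \<Rightarrow> bool" where
  "positive_map \<Psi> \<longleftrightarrow> (\<forall>X. psd X \<longrightarrow> psd (\<Psi> X))"

definition KS :: "('n::finite op \<Rightarrow> 'n op) \<Rightarrow> bool" where
  "KS \<Psi> \<longleftrightarrow> unital_linear \<Psi> \<and> (\<forall>X. op_le (adj (\<Psi> X) ** \<Psi> X) (\<Psi> (adj X ** X)))"

definition co_KS :: "('n::finite op \<Rightarrow> 'n op) \<Rightarrow> bool" where
  "co_KS \<Psi> \<longleftrightarrow> unital_linear \<Psi> \<and> (\<forall>X. op_le (\<Psi> X ** adj (\<Psi> X)) (\<Psi> (adj X ** X)))"

definition KS_decomposable :: "('n::finite op \<Rightarrow> 'n op) \<Rightarrow> bool" where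
  "KS_decomposable \<Phi> \<longleftrightarrow> unital_linear \<Phi> \<and> positive_map \<Phi> \<and>
     (\<exists>\<Phi>\<^sub>1 \<Phi>\<^sub>2 l. KS \<Phi>\<^sub>1 \<and> co_KS \<Phi>\<^sub>2 \<and> l \<in> {0..1::real} \<and>
        (\<forall>X. \<Phi> X = l *\<^sub>R \<Phi>\<^sub>1 X + (1 - l) *\<^sub>R \<Phi>\<^sub>2 X))"

definition R :: "real \<Rightarrow> 'n::finite op \<Rightarrow> 'n op" where
  "R a X = (1 / (real CARD('n) - a)) *\<^sub>R (op_scale (trace X) (mat 1) - a *\<^sub>R X)"

end

theory Submission
  imports Defs
begin

text \<open>For \<open>\<bar>a\<bar> \<le> 1\<close> and \<open>a < d\<close> the map \<open>R a\<close> is itself co-KS, so that the decomposition with weight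
  \<open>0\<close> on the KS part is enough.

  Let \<open>E i j\<close> denote the matrix units and put \<open>K i j = \<alpha> E i j - \<beta> E j i\<close> with real \<open>\<alpha>\<close>, \<open>\<beta>\<close>. Summing
  \<open>(K i j)\<^sup>* X\<^sup>T (K i j)\<close> over all \<open>i\<close>, \<open>j\<close> gives \<open>(\<alpha>\<^sup>2 + \<beta>\<^sup>2) Tr(X) 1 - 2 \<alpha> \<beta> X\<close>
  (\<open>co_Kraus_swap_family\<close>). This is \<open>R a X\<close> as soon as \<open>\<alpha>\<^sup>2 + \<beta>\<^sup>2 = 1 / (d - a)\<close> and
  \<open>2 \<alpha> \<beta> = a / (d - a)\<close>, which has a real solution because \<open>\<bar>a\<bar> \<le> 1\<close>. Hence \<open>R a\<close> is completely
  copositive. A unital completely copositive map is positive (\<open>positive_map_co_Kraus\<close>) and co-KS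
  (\<open>co_KS_co_Kraus\<close>); the latter is the Schwarz inequality, whose defect is written as a sum of
  squared norms.\<close>

section \<open>The inner product and the adjoint\<close>

lemma cinner_add_right: "cinner v (w + w') = cinner v w + cinner v w'"
  by (simp add: cinner_def algebra_simps sum.distrib)

lemma cinner_diff_right: "cinner v (w - w') = cinner v w - cinner v w'"
  by (simp add: cinner_def algebra_simps sum_subtractf)

lemma cinner_diff_left: "cinner (v - v') w = cinner v w - cinner v' w"
  by (simp add: cinner_def algebra_simps sum_subtractf)

lemma cinner_zero_right [simp]: "cinner v 0 = 0"
  by (simp add: cinner_def)

lemma cnj_cinner: "cnj (cinner v w) = cinner w v"
  by (simp add: cinner_def mult.commute)

lemma cinner_self_nonneg: "0 \<le> cinner v v"
  unfolding cinner_def by (intro sum_nonneg) (simp add: less_eq_complex_def)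

lemma adj_adj [simp]: "adj (adj A) = A"
  by (simp add: adj_def vec_eq_iff)

lemma cinner_adj_right: "cinner v (adj A *v w) = cinner (A *v v) w"
  using cinner_adj[of "adj A" v w] by simp

lemma transpose_adj: "transpose (adj A) = adj (transpose A)"
  by (simp add: adj_def transpose_def vec_eq_iff)

lemma psd_zero: "psd 0"
  by (simp add: psd_def)

lemma psd_transpose:
  assumes "psd A"
  shows "psd (transpose A)"
  unfolding psd_def
proof
  fix v :: "complex ^ 'a"
  let ?u = "\<chi> i. cnj (v $ i)"
  have "cinner v (transpose A *v v) = (\<Sum>i\<in>UNIV. \<Sum>j\<in>UNIV. cnj (v $ i) * A $ j $ i * v $ j)"
    by (simp add: cinner_def matrix_vector_mult_def transpose_def sum_distrib_left mult_ac)
  also have "\<dots> = (\<Sum>j\<in>UNIV. \<Sum>i\<in>UNIV. cnj (v $ i) * A $ j $ i * v $ j)"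
    by (rule sum.swap)
  also have "\<dots> = cinner ?u (A *v ?u)"
    by (simp add: cinner_def matrix_vector_mult_def sum_distrib_left mult_ac)
  finally show "0 \<le> cinner v (transpose A *v v)"
    using assms by (simp add: psd_def)
qed

section \<open>Completely copositive maps\<close>

text \<open>The completely copositive map with Kraus operators \<open>K m\<close>, \<open>m \<in> I\<close>: a completely positive map
  in Kraus form preceded by the transposition. The index set is meant to be finite.\<close>

definition co_Kraus :: "'m set \<Rightarrow> ('m \<Rightarrow> 'n::finite op) \<Rightarrow> 'n op \<Rightarrow> 'n op" where
  "co_Kraus I K X = (\<Sum>m\<in>I. adj (K m) ** transpose X ** K m)"

lemma cinner_co_Kraus:
  assumes "finite I"
  shows "cinner v (co_Kraus I K X *v w) = (\<Sum>m\<in>I. cinner (K m *v v) (transpose X *v (K m *v w)))"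
  unfolding co_Kraus_def using assms
  by (induction I)
    (simp_all add: matrix_vector_mult_add_rdistrib cinner_add_right cinner_adj_right
      flip: matrix_vector_mul_assoc)

lemma positive_map_co_Kraus:
  fixes K :: "'m \<Rightarrow> 'n::finite op"
  assumes "finite I"
  shows "positive_map (co_Kraus I K)"
  unfolding positive_map_def
proof (intro allI impI)
  fix X :: "'n op"
  assume "psd X"
  then have "psd (transpose X)"
    by (rule psd_transpose)
  then show "psd (co_Kraus I K X)"
    unfolding psd_def cinner_co_Kraus[OF assms] by (intro allI sum_nonneg) blast
qed

lemma linear_co_Kraus: "Vector_Spaces.linear op_scale op_scale (co_Kraus I K)"
proof -
  have "co_Kraus I K (X + Y) = co_Kraus I K X + co_Kraus I K Y" for X Y
    by (simp add: co_Kraus_def vec_eq_iff matrix_matrix_mult_def transpose_def algebra_simps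
        sum.distrib)
  moreover have "co_Kraus I K (op_scale c X) = op_scale c (co_Kraus I K X)" for c X
    by (simp add: co_Kraus_def op_scale_def vec_eq_iff matrix_matrix_mult_def transpose_def
        sum_distrib_left mult_ac)
  ultimately show ?thesis
    by (simp add: Vector_Spaces.linear_iff vector_space_op_scale)
qed

lemma co_KS_co_Kraus:
  fixes K :: "'m \<Rightarrow> 'n::finite op"
  assumes fin: "finite I" and unital: "co_Kraus I K (mat 1) = mat 1"
  shows "co_KS (co_Kraus I K)"
  unfolding co_KS_def unital_linear_def op_le_def psd_def
proof (intro conjI allI linear_co_Kraus unital)
  fix X :: "'n op" and v
  let ?P = "co_Kraus I K" and ?T = "transpose X"
  define w where "w = adj (?P X) *v v"
  \<comment> \<open>The defect of the Schwarz inequality at \<open>v\<close> is the sum of the squared norms of these vectors.\<close>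
  define u where "u m = adj ?T *v (K m *v v) - K m *v w" for m
  have Pw: "cinner v (?P X *v w) = cinner w w"
    by (simp add: w_def cinner_adj)
  have 1: "(\<Sum>m\<in>I. cinner (adj ?T *v (K m *v v)) (adj ?T *v (K m *v v)))
      = cinner v (?P (adj X ** X) *v v)"
    by (simp add: cinner_co_Kraus[OF fin] matrix_transpose_mul transpose_adj cinner_adj
        flip: matrix_vector_mul_assoc)
  have 2: "(\<Sum>m\<in>I. cinner (adj ?T *v (K m *v v)) (K m *v w)) = cinner w w"
    by (simp add: cinner_co_Kraus[OF fin] cinner_adj flip: Pw)
  have 3: "(\<Sum>m\<in>I. cinner (K m *v w) (adj ?T *v (K m *v v))) = cinner w w"
    using arg_cong[OF 2, of cnj] by (simp add: cnj_cinner)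
  have 4: "(\<Sum>m\<in>I. cinner (K m *v w) (K m *v w)) = cinner w w"
    using cinner_co_Kraus[OF fin, of w K "mat 1" w] by (simp add: unital transpose_mat)
  have "cinner v ((?P (adj X ** X) - ?P X ** adj (?P X)) *v v)
      = cinner v (?P (adj X ** X) *v v) - cinner w w"
    by (simp add: matrix_vector_mult_diff_rdistrib cinner_diff_right w_def cinner_adj
        flip: matrix_vector_mul_assoc)
  also have "\<dots> = (\<Sum>m\<in>I. cinner (u m) (u m))"
    by (simp add: u_def cinner_diff_left cinner_diff_right sum_subtractf sum.distrib 1 2 3 4)
  finally show "0 \<le> cinner v ((?P (adj X ** X) - ?P X ** adj (?P X)) *v v)"
    by (simp add: sum_nonneg cinner_self_nonneg)
qed

section \<open>The generalised reduction maps\<close>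

lemma matrix_diff_ldistrib: "A ** (B - C) = A ** B - A ** (C :: 'a::ring_1 ^ 'n ^ 'm)"
  by (simp add: vec_eq_iff matrix_matrix_mult_def right_diff_distrib sum_subtractf)

lemma matrix_diff_rdistrib: "(A - B) ** C = A ** C - B ** (C :: 'a::ring_1 ^ 'n ^ 'm)"
  by (simp add: vec_eq_iff matrix_matrix_mult_def left_diff_distrib sum_subtractf)

text \<open>The matrix unit with entry \<open>1\<close> in row \<open>i\<close> and column \<open>j\<close>, and \<open>0\<close> elsewhere.\<close>

definition matrix_unit :: "'n \<Rightarrow> 'n \<Rightarrow> 'n::finite op" where
  "matrix_unit i j = (\<chi> r s. of_bool (r = i \<and> s = j))"

lemma matrix_unit_nth: "matrix_unit i j $ r $ s = of_bool (r = i) * of_bool (s = j)"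
  by (simp add: matrix_unit_def)

lemma matrix_unit_sandwich:
  "matrix_unit i j ** A ** matrix_unit k l = op_scale (A $ j $ k) (matrix_unit i l)"
proof -
  have "(matrix_unit i j ** A ** matrix_unit k l) $ r $ s
      = (op_scale (A $ j $ k) (matrix_unit i l)) $ r $ s" for r s
    by (cases "r = i"; cases "s = l")
      (simp_all add: matrix_matrix_mult_def matrix_unit_nth op_scale_def of_bool_def
        if_distrib[of "\<lambda>c. c * _"] if_distrib[of "\<lambda>c. _ * c"] cong: if_cong)
  then show ?thesis
    by (simp add: vec_eq_iff)
qed

lemma sum_matrix_units: "(\<Sum>i\<in>UNIV. \<Sum>j\<in>UNIV. op_scale (X $ i $ j) (matrix_unit i j)) = X"
  by (simp add: vec_eq_iff op_scale_def matrix_unit_nth of_bool_def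
        if_distrib[of "\<lambda>c. c * _"] if_distrib[of "\<lambda>c. _ * c"] cong: if_cong)

lemma sum_diagonal_matrix_units:
  "(\<Sum>i\<in>UNIV. \<Sum>j\<in>UNIV. op_scale (X $ i $ i) (matrix_unit j j)) = op_scale (trace X) (mat 1)"
  by (simp add: vec_eq_iff op_scale_def matrix_unit_nth of_bool_def mat_def trace_def
        if_distrib[of "\<lambda>c. c * _"] if_distrib[of "\<lambda>c. _ * c"] cong: if_cong)

lemma co_Kraus_swap_family:
  fixes \<alpha> \<beta> :: real and X :: "'n::finite op"
  shows "co_Kraus UNIV (\<lambda>(i, j). \<alpha> *\<^sub>R matrix_unit i j - \<beta> *\<^sub>R matrix_unit j i) X
    = (\<alpha>\<^sup>2 + \<beta>\<^sup>2) *\<^sub>R op_scale (trace X) (mat 1) - (2 * \<alpha> * \<beta>) *\<^sub>R X"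
proof -
  let ?E = "matrix_unit :: 'n \<Rightarrow> 'n \<Rightarrow> 'n op"
  let ?K = "\<lambda>i j. \<alpha> *\<^sub>R ?E i j - \<beta> *\<^sub>R ?E j i"
  have adj_K: "adj (?K i j) = \<alpha> *\<^sub>R ?E j i - \<beta> *\<^sub>R ?E i j" for i j
    by (simp add: adj_def matrix_unit_nth vec_eq_iff mult.commute)
  have summand: "adj (?K i j) ** transpose X ** ?K i j =
      \<alpha>\<^sup>2 *\<^sub>R op_scale (X $ i $ i) (?E j j) - (\<alpha> * \<beta>) *\<^sub>R op_scale (X $ j $ i) (?E j i)
      - (\<alpha> * \<beta>) *\<^sub>R op_scale (X $ i $ j) (?E i j) + \<beta>\<^sup>2 *\<^sub>R op_scale (X $ j $ j) (?E i i)" for i j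
    by (simp add: adj_K matrix_diff_ldistrib matrix_diff_rdistrib matrix_scalar_ac
        matrix_unit_sandwich algebra_simps power2_eq_square transpose_def flip: scalar_matrix_assoc)
  have swap: "(\<Sum>i\<in>UNIV. \<Sum>j\<in>UNIV. op_scale (X $ j $ i) (?E j i)) = X"
    "(\<Sum>i\<in>UNIV. \<Sum>j\<in>UNIV. op_scale (X $ j $ j) (?E i i)) = op_scale (trace X) (mat 1)"
    by (subst sum.swap, simp add: sum_matrix_units sum_diagonal_matrix_units)+
  have "co_Kraus UNIV (\<lambda>(i, j). ?K i j) X
      = (\<Sum>i\<in>UNIV. \<Sum>j\<in>UNIV. adj (?K i j) ** transpose X ** ?K i j)"
    by (simp add: co_Kraus_def sum.cartesian_product case_prod_unfold)
  also have "\<dots> = \<alpha>\<^sup>2 *\<^sub>R op_scale (trace X) (mat 1) - (\<alpha> * \<beta>) *\<^sub>R X - (\<alpha> * \<beta>) *\<^sub>R X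
      + \<beta>\<^sup>2 *\<^sub>R op_scale (trace X) (mat 1)"
    by (simp add: summand sum.distrib sum_subtractf sum_matrix_units sum_diagonal_matrix_units swap
        flip: scaleR_sum_right)
  finally show ?thesis
    by (simp add: algebra_simps flip: scaleR_add_left)
qed

theorem theorem4p4:
  fixes a :: real
  assumes "a \<in> {0..1}" and "a \<noteq> real CARD('n::finite)"
  shows "KS_decomposable (R a :: 'n op \<Rightarrow> 'n op)"
proof -
  define k where "k = real CARD('n) - a"
  have "1 \<le> real CARD('n)"
    by (simp add: Suc_le_eq)
  with assms have k: "0 < k"
    unfolding k_def atLeastAtMost_iff by linarith
  have a: "0 \<le> 1 + a" "0 \<le> 1 - a"
    using assms by simp_all
  \<comment> \<open>Chosen so that \<open>(\<alpha> + \<beta>)\<^sup>2 = (1 + a) / k\<close> and \<open>(\<alpha> - \<beta>)\<^sup>2 = (1 - a) / k\<close>.\<close>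
  define \<alpha> where "\<alpha> = (sqrt ((1 + a) / k) + sqrt ((1 - a) / k)) / 2"
  define \<beta> where "\<beta> = (sqrt ((1 + a) / k) - sqrt ((1 - a) / k)) / 2"
  have sq: "(\<alpha> + \<beta>)\<^sup>2 = (1 + a) / k" "(\<alpha> - \<beta>)\<^sup>2 = (1 - a) / k"
    using a k by (simp_all add: \<alpha>_def \<beta>_def field_simps)
  have sum_sq: "\<alpha>\<^sup>2 + \<beta>\<^sup>2 = 1 / k"
    using sq k by (simp add: power2_sum power2_diff field_simps)
  have cross: "2 * \<alpha> * \<beta> = a / k"
    using sq k by (simp add: power2_sum power2_diff field_simps)
  let ?K = "\<lambda>(i, j). \<alpha> *\<^sub>R matrix_unit i j - \<beta> *\<^sub>R matrix_unit j i :: 'n op"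
  have R_eq: "R a = co_Kraus UNIV ?K"
  proof
    fix X :: "'n op"
    show "R a X = co_Kraus UNIV ?K X"
      unfolding co_Kraus_swap_family sum_sq cross
      by (simp add: R_def scaleR_diff_right flip: k_def)
  qed
  have unital: "R a (mat 1) = (mat 1 :: 'n op)"
  proof -
    have "op_scale (trace (mat 1 :: 'n op)) (mat 1) = real CARD('n) *\<^sub>R (mat 1 :: 'n op)"
      by (simp add: trace_def mat_def op_scale_def vec_eq_iff scaleR_conv_of_real[where 'a = complex])
    then have "R a (mat 1) = (1 / k) *\<^sub>R (k *\<^sub>R (mat 1 :: 'n op))"
      by (simp add: R_def k_def flip: scaleR_left_diff_distrib)
    with k show ?thesis
      by simp
  qed
  have co_KS: "co_KS (R a :: 'n op \<Rightarrow> 'n op)"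
    using co_KS_co_Kraus[of UNIV ?K] unital by (simp add: R_eq)
  have KS: "KS (\<lambda>X :: 'n op. X)"
    by (simp add: KS_def unital_linear_def Vector_Spaces.linear_iff vector_space_op_scale op_le_def
        psd_zero)
  have "R a X = 0 *\<^sub>R X + (1 - 0) *\<^sub>R R a X" for X :: "'n op"
    by simp
  moreover have "(0 :: real) \<in> {0..1}"
    by simp
  moreover have "positive_map (R a :: 'n op \<Rightarrow> 'n op)"
    unfolding R_eq by (intro positive_map_co_Kraus finite)
  moreover have "unital_linear (R a :: 'n op \<Rightarrow> 'n op)"
    using co_KS by (simp add: co_KS_def)
  ultimately show ?thesis
    unfolding KS_decomposable_def using KS co_KS by blast
qed

end
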